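(* Let $g$ be a generic lightlike metric on a manifold $M$ of dimension $n \geq 4$. Then for every $x \in M$, every $3$-infinitesimal isometry of $g$ at $x$ with trivial $1$-jet has trivial $2$-jet: $$\phi \in \mathrm{Iso}^3_x(g), \quad \mathrm{jet}^1_x(\phi) = 1 \ \Longrightarrow\ \mathrm{jet}^2_x(\phi) = 1.$$
   Context: All objects are smooth. A lightlike scalar product on a real vector space is a positive (semi-definite) symmetric bilinear form whose kernel has dimension one. A lightlike metric $g$ on a manifold $M$ is a symmetric $2$-tensor field which is a lightlike scalar product on each tangent space. Its kernel is a line sub-bundle $N \subset TM$, called the characteristic direction field. For a vector field $X$ tangent to $N$, the Lie derivative $L_X g$ annihilates $N$ (i.e. $L_Xg(u,v)=0$ whenever $u \in N$). If $X'$ is another (non-singular) vector field tangent to $N$, then $L_{X'}g = f\, L_Xg$ for some function $f$. The metric $g$ is called generic if, for (local) non-singular vector fields $X$ tangent to $N$, $L_X g$ has maximal rank at every point, i.e. its kernel is exactly $N$ (so that $L_Xg$ induces a nondegenerate symmetric bilinear form on $TM/N$). For $x \in M$ and an integer $k \ge 0$, $\mathrm{Iso}^{k+1}_x(g)$ is the group of $(k+1)$-jets at $x$ of local diffeomorphisms $\phi$ of $M$ fixing $x$ such that $\phi^*g - g$ vanishes up to order $k$ at $x$ (i.e. has zero $k$-jet at $x$). Its elements are called $(k+1)$-infinitesimal isometries at $x$. The notation $\mathrm{jet}^k_x(\phi) = 1$ means that $\phi$ has the same $k$-jet at $x$ as the identity map. *)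

theory Defs
  imports "HOL-Analysis.Analysis"
begin

section \<open>Smooth maps and jets in \<open>\<real>\<^sup>n\<close>\<close>

text \<open>\<open>iter_deriv [v\<^sub>1, \<dots>, v\<^sub>k] f x\<close> is the value at \<open>x\<close> of the iterated directional
  derivative of \<open>f\<close> along the constant fields \<open>v\<^sub>k, \<dots>, v\<^sub>1\<close>. The family of these values for
  \<open>k \<le> r\<close> is the \<open>r\<close>-jet of \<open>f\<close> at \<open>x\<close>.\<close>

primrec iter_deriv ::
  "'a::real_normed_vector list \<Rightarrow> ('a \<Rightarrow> 'b::real_normed_vector) \<Rightarrow> 'a \<Rightarrow> 'b" where
  "iter_deriv [] f = f"
| "iter_deriv (v # vs) f = (\<lambda>x. frechet_derivative (iter_deriv vs f) (at x) v)"

text \<open>Used for open \<open>S\<close> in a finite-dimensional space only. There it is the usual \<open>C\<^sup>\<infinity>\<close> condition: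
  all partial derivatives of all orders exist and are differentiable, hence continuous.\<close>

definition smooth_on :: "'a::real_normed_vector set \<Rightarrow> ('a \<Rightarrow> 'b::real_normed_vector) \<Rightarrow> bool" where
  "smooth_on S f \<longleftrightarrow> (\<forall>vs. \<forall>x\<in>S. iter_deriv vs f differentiable (at x))"

definition eq_to_order ::
  "nat \<Rightarrow> 'a::real_normed_vector \<Rightarrow> ('a \<Rightarrow> 'b::real_normed_vector) \<Rightarrow> ('a \<Rightarrow> 'b) \<Rightarrow> bool" where
  "eq_to_order k x f h \<longleftrightarrow> (\<forall>vs. length vs \<le> k \<longrightarrow> iter_deriv vs f x = iter_deriv vs h x)"

section \<open>Smooth manifolds\<close>

text \<open>The manifold is the type \<open>'m\<close>, equipped with an atlas of charts, each given by its domain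
  and its coordinate map.\<close>

type_synonym ('m, 'n) chart = "'m set \<times> ('m \<Rightarrow> real ^ 'n)"

abbreviation cdom :: "('m, 'n) chart \<Rightarrow> 'm set" where "cdom \<equiv> fst"
abbreviation cmap :: "('m, 'n) chart \<Rightarrow> 'm \<Rightarrow> real ^ 'n" where "cmap \<equiv> snd"

definition cinv :: "('m, 'n) chart \<Rightarrow> real ^ 'n \<Rightarrow> 'm" where
  "cinv c = inv_into (cdom c) (cmap c)"

definition crange :: "('m, 'n) chart \<Rightarrow> (real ^ 'n) set" where
  "crange c = cmap c ` cdom c"

definition is_chart :: "('m::topological_space, 'n::finite) chart \<Rightarrow> bool" where
  "is_chart c \<longleftrightarrow> open (cdom c) \<and> open (crange c) \<and>
     homeomorphism (cdom c) (crange c) (cmap c) (cinv c)"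

text \<open>Coordinate expression of a map, from the chart \<open>c\<close> to the chart \<open>d\<close>. For the identity map
  this is the change of coordinates.\<close>

definition crep :: "('m, 'n) chart \<Rightarrow> ('m, 'n) chart \<Rightarrow> ('m \<Rightarrow> 'm) \<Rightarrow> real ^ 'n \<Rightarrow> real ^ 'n" where
  "crep c d f = (\<lambda>y. cmap d (f (cinv c y)))"

definition smooth_atlas ::
  "('m::{t2_space, second_countable_topology}, 'n::finite) chart set \<Rightarrow> bool" where
  "smooth_atlas A \<longleftrightarrow>
     (\<forall>c\<in>A. is_chart c) \<and> (\<Union>c\<in>A. cdom c) = UNIV \<and>
     (\<forall>c\<in>A. \<forall>d\<in>A. smooth_on (cmap c ` (cdom c \<inter> cdom d)) (crep c d id))"

definition smooth_map_on ::
  "('m::topological_space, 'n::finite) chart set \<Rightarrow> 'm set \<Rightarrow> ('m \<Rightarrow> 'm) \<Rightarrow> bool" where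
  "smooth_map_on A U f \<longleftrightarrow> continuous_on U f \<and>
     (\<forall>c\<in>A. \<forall>d\<in>A. smooth_on (cmap c ` (U \<inter> cdom c \<inter> f -` cdom d)) (crep c d f))"

text \<open>Local diffeomorphisms fixing \<open>x\<close>, represented by total functions whose values matter only
  near \<open>x\<close>.\<close>

definition local_diffeos ::
  "('m::topological_space, 'n::finite) chart set \<Rightarrow> 'm \<Rightarrow> ('m \<Rightarrow> 'm) set" where
  "local_diffeos A x = {\<phi>. \<phi> x = x \<and>
     (\<exists>U. open U \<and> x \<in> U \<and> open (\<phi> ` U) \<and> inj_on \<phi> U \<and>
        smooth_map_on A U \<phi> \<and> smooth_map_on A (\<phi> ` U) (inv_into U \<phi>))}"

text \<open>The \<open>k\<close>-jet at \<open>x\<close> of a local diffeomorphism fixing \<open>x\<close>, as an equivalence class.\<close>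

definition jet ::
  "('m::topological_space, 'n::finite) chart set \<Rightarrow> nat \<Rightarrow> 'm \<Rightarrow> ('m \<Rightarrow> 'm) \<Rightarrow> ('m \<Rightarrow> 'm) set" where
  "jet A k x \<phi> = {\<psi> \<in> local_diffeos A x.
     \<forall>c\<in>A. x \<in> cdom c \<longrightarrow> eq_to_order k (cmap c x) (crep c c \<psi>) (crep c c \<phi>)}"

section \<open>Lightlike metrics\<close>

definition form_kernel :: "('a \<Rightarrow> 'a \<Rightarrow> real) \<Rightarrow> 'a set" where
  "form_kernel b = {u. \<forall>v. b u v = 0}"

definition lightlike_form :: "('a::euclidean_space \<Rightarrow> 'a \<Rightarrow> real) \<Rightarrow> bool" where
  "lightlike_form b \<longleftrightarrow> bilinear b \<and> (\<forall>u v. b u v = b v u) \<and> (\<forall>u. b u u \<ge> 0) \<and>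
     dim (form_kernel b) = 1"

text \<open>A field of bilinear forms in coordinates, and its pullback by a map \<open>f\<close> between open sets of
  \<open>\<real>\<^sup>n\<close>.\<close>

type_synonym 'n form_field = "real ^ 'n \<Rightarrow> real ^ 'n \<Rightarrow> real ^ 'n \<Rightarrow> real"

definition pullback :: "(real ^ 'n \<Rightarrow> real ^ 'n) \<Rightarrow> 'n::finite form_field \<Rightarrow> 'n form_field" where
  "pullback f h = (\<lambda>y u v. h (f y) (frechet_derivative f (at y) u) (frechet_derivative f (at y) v))"

text \<open>A covariant 2-tensor field on the manifold is given by its coordinate expressions \<open>g c\<close> in
  the charts \<open>c\<close>, functions of the coordinates, related by pullback along changes of coordinates.\<close>

definition lightlike_metric ::
  "('m::topological_space, 'n::finite) chart set \<Rightarrow> (('m, 'n) chart \<Rightarrow> 'n form_field) \<Rightarrow> bool" where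
  "lightlike_metric A g \<longleftrightarrow>
     (\<forall>c\<in>A. (\<forall>y\<in>crange c. lightlike_form (g c y)) \<and>
            (\<forall>u v. smooth_on (crange c) (\<lambda>y. g c y u v))) \<and>
     (\<forall>c\<in>A. \<forall>d\<in>A. \<forall>y\<in>cmap c ` (cdom c \<inter> cdom d). g c y = pullback (crep c d id) (g d) y)"

text \<open>Evaluating \<open>(L\<^sub>X h)(U, V) = X (h(U, V)) - h([X, U], V) - h(U, [X, V])\<close> on constant fields
  \<open>U = u\<close>, \<open>V = v\<close>, for which \<open>[X, U] = - DX(u)\<close>.\<close>

definition lie_derivative ::
  "(real ^ 'n \<Rightarrow> real ^ 'n) \<Rightarrow> 'n::finite form_field \<Rightarrow> 'n form_field" where
  "lie_derivative X h = (\<lambda>y u v.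
     frechet_derivative (\<lambda>z. h z u v) (at y) (X y) +
     h y (frechet_derivative X (at y) u) v + h y u (frechet_derivative X (at y) v))"

text \<open>The fields \<open>X\<close> are the coordinate expressions of local non-singular vector fields tangent to
  the characteristic direction field; it suffices to test those defined in a chart domain, as the
  condition on \<open>X\<close> is pointwise.\<close>

definition generic_metric ::
  "('m, 'n::finite) chart set \<Rightarrow> (('m, 'n) chart \<Rightarrow> 'n form_field) \<Rightarrow> bool" where
  "generic_metric A g \<longleftrightarrow>
     (\<forall>c\<in>A. \<forall>W X. open W \<and> W \<subseteq> crange c \<and> smooth_on W X \<and>
        (\<forall>y\<in>W. X y \<noteq> 0 \<and> X y \<in> form_kernel (g c y)) \<longrightarrow>
        (\<forall>y\<in>W. form_kernel (lie_derivative X (g c) y) = form_kernel (g c y)))"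

text \<open>The jets in \<open>Iso\<^sup>m\<^sub>x(g)\<close>, \<open>m \<ge> 1\<close>. As \<open>\<phi>\<close> fixes \<open>x\<close>, its expression in one chart around
  \<open>x\<close>, used at both ends, determines \<open>\<phi>\<^sup>*g\<close> near \<open>x\<close>.\<close>

definition Iso ::
  "('m::topological_space, 'n::finite) chart set \<Rightarrow> (('m, 'n) chart \<Rightarrow> 'n form_field) \<Rightarrow>
   nat \<Rightarrow> 'm \<Rightarrow> ('m \<Rightarrow> 'm) set set" where
  "Iso A g m x = {jet A m x \<phi> | \<phi> k. m = k + 1 \<and> \<phi> \<in> local_diffeos A x \<and>
     (\<forall>c\<in>A. x \<in> cdom c \<longrightarrow>
        (\<forall>u v. eq_to_order k (cmap c x)
           (\<lambda>y. pullback (crep c c \<phi>) (g c) y u v - g c y u v) (\<lambda>y. 0)))}"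

end

theory Submission imports Defs begin

text \<open>In a chart at \<open>x\<close>, let \<open>Q\<close> and \<open>C\<close> be the second and third derivatives of \<open>\<phi>\<close> at \<open>x\<close>. At first order the
  isometry equation says that \<open>g(Q(w, u), v)\<close> is skew in \<open>u, v\<close>; as it is symmetric in \<open>w, u\<close>, it vanishes,
  and \<open>Q = q n\<close> for a generator \<open>n\<close> of the characteristic direction. At second order, the terms
  with \<open>C\<close> cancel in the combination of the equations that defines the linearised curvature, and what
  remains is \<open>q(z, w) L(u, v) + q(u, v) L(z, w) = q(z, u) L(w, v) + q(w, v) L(z, u)\<close>, where \<open>L = L\<^sub>X g\<close> for a
  field \<open>X\<close> tangent to \<open>N\<close> with \<open>X(x) = n\<close>. By genericity \<open>L\<close> has corank one, hence rank at least three, which forces \<open>q = 0\<close>.\<close>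

section \<open>Kulkarni--Nomizu products\<close>

text \<open>The common zeros of two functionals have dimension at least \<open>DIM('a) - 2\<close>,
  hence at least two, which exceeds \<open>dim K\<close>. This count is the essential use of
  dimension at least four.\<close>

lemma common_zeros_not_in_line:
  fixes f g :: "'a::euclidean_space \<Rightarrow> real"
  assumes "DIM('a) \<ge> 4" and "linear f" and "linear g" and "dim K = 1"
  shows "\<exists>v. f v = 0 \<and> g v = 0 \<and> v \<notin> K"
proof (rule ccontr)
  assume "\<not> ?thesis"
  then have sub: "{v. f v = 0 \<and> g v = 0} \<subseteq> K" by blast
  \<comment> \<open>Representing the functionals by vectors turns their common zeros into an
    orthogonal complement, whose dimension is known.\<close>
  have riesz: "\<exists>a. \<forall>v. h v = a \<bullet> v" if "linear h" for h :: "'a \<Rightarrow> real"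
    using adjoint_works[OF that, of _ 1] by (intro exI[of _ "adjoint h 1"]) (simp add: inner_commute)
  obtain a b where ab: "\<And>v. f v = a \<bullet> v" "\<And>v. g v = b \<bullet> v"
    using riesz[OF assms(2)] riesz[OF assms(3)] by blast
  have "dim {y \<in> UNIV. \<forall>x \<in> span {a, b}. orthogonal x y} + dim (span {a, b}) = dim (UNIV :: 'a set)"
    by (rule dim_subspace_orthogonal_to_vectors) auto
  moreover have "{y \<in> UNIV. \<forall>x \<in> span {a, b}. orthogonal x y} \<subseteq> {v. f v = 0 \<and> g v = 0}"
    using span_base[of _ "{a, b}"] by (auto simp: ab orthogonal_def)
  then have "dim {y \<in> UNIV. \<forall>x \<in> span {a, b}. orthogonal x y} \<le> dim K"
    using sub by (intro dim_subset) blast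
  moreover have "dim (span {a, b}) \<le> 2"
    using dim_le_card'[of "{a, b}"] card_insert_le_m1[of 2 "{b}" a] by simp
  ultimately show False using assms(1,4) by simp
qed

text \<open>\<open>KN\<close> says that the Kulkarni-Nomizu product of \<open>q\<close> and
  \<open>S\<close> vanishes, and \<open>S\<close> has rank at least three. On the
  \<open>S\<close>-complement of a vector \<open>e\<close> with \<open>S e e\<close> nonzero,
  \<open>q\<close> is a multiple of \<open>S\<close>. A nonzero multiple, or a nonzero mixed value
  \<open>q z e\<close>, would give \<open>S\<close> rank at most one there, whereas its rank there
  is at least two.\<close>

lemma kulkarni_nomizu_zero:
  fixes q S :: "'a::euclidean_space \<Rightarrow> 'a \<Rightarrow> real"
  assumes dim4: "DIM('a) \<ge> 4"
    and S: "bilinear S" "\<And>u v. S u v = S v u" "dim (form_kernel S) = 1"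
    and q: "\<And>w. linear (\<lambda>z. q z w)" "\<And>z w. q z w = q w z"
    and KN: "\<And>z w u v. q z w * S u v + q u v * S z w = q z u * S w v + q w v * S z u"
  shows "q z w = 0"
proof -
  have lin: "linear (S u)" for u
    using S(1) by (simp add: bilinear_def)
  have ker: "v \<in> form_kernel S \<longleftrightarrow> (\<forall>u. S u v = 0)" for v
    by (auto simp: form_kernel_def S(2)[of v])
  have sub: "S u (v + r *\<^sub>R w) = S u v + r * S u w" for u v r w
    using lin[of u] by (simp add: linear_add linear_cmul)
  have qsub: "q (v + r *\<^sub>R w) u = q v u + r * q w u" for u v r w
    using linear_add[OF q(1)[of u]] linear_cmul[OF q(1)[of u]] by simp
  \<comment> \<open>By polarisation a symmetric form with zero diagonal vanishes, and then its
    kernel would be the whole space.\<close>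
  obtain e where e: "S e e \<noteq> 0"
  proof (rule ccontr)
    assume "\<not> thesis"
    then have diag: "S v v = 0" for v using that by blast
    have "S u v = 0" for u v
      using diag[of "u + v"] diag[of u] diag[of v] S(2)[of v u]
      by (simp add: bilinear_ladd[OF S(1)] bilinear_radd[OF S(1)])
    then have "form_kernel S = UNIV" by (auto simp: form_kernel_def)
    then show False using S(3) dim4 by simp
  qed
  \<comment> \<open>Split along the \<open>S\<close>-orthogonal complement of \<open>e\<close>, so that no diagonalisation of the possibly
    indefinite \<open>S\<close> is needed.\<close>
  define P where "P v = v + (- S e v / S e e) *\<^sub>R e" for v
  have SP: "S e (P v) = 0" for v
    using e sub[of e v "- S e v / S e e" e] by (simp add: P_def)
  \<comment> \<open>Each \<open>u\<close> is \<open>P u\<close> plus a multiple of \<open>e\<close>,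
    so orthogonality to the complement and to \<open>e\<close> suffices.\<close>
  have perp_ker: "v \<in> form_kernel S" if "S e v = 0" "\<And>u. S e u = 0 \<Longrightarrow> S u v = 0" for v
  proof -
    have "S u v = 0" for u
      using that(2)[OF SP[of u]] that(1) sub[of v u "- S e u / S e e" e] S(2)[of v u] S(2)[of v e] S(2)[of v "P u"]
      by (simp add: P_def)
    then show ?thesis by (simp add: ker)
  qed
  \<comment> \<open>This excludes rank at most one on the complement of \<open>e\<close>: a common
    zero of \<open>f\<close> and \<open>S e\<close> would lie in the kernel by
    \<open>perp_ker\<close>, yet some such zero lies outside it.\<close>
  have no_factor: "\<not> (\<forall>u v. S e u = 0 \<longrightarrow> S e v = 0 \<longrightarrow> S u v = f v * \<sigma> u)" if f: "linear f" for f \<sigma>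
  proof
    assume fac: "\<forall>u v. S e u = 0 \<longrightarrow> S e v = 0 \<longrightarrow> S u v = f v * \<sigma> u"
    obtain v where "f v = 0" "S e v = 0" "v \<notin> form_kernel S"
      using common_zeros_not_in_line[OF dim4 f lin S(3)] by blast
    then show False using perp_ker[of v] fac by simp
  qed
  define c where "c = q e e / S e e"
  have on_perp: "q z w = - c * S z w" if "S e z = 0" "S e w = 0" for z w
    using KN[of z w e e] that e S(2)[of z e] S(2)[of w e] by (simp add: c_def field_simps)
  have c0: "c = 0"
  proof (rule ccontr)
    assume "c \<noteq> 0"
    have SS: "S z w * S u v = S z u * S w v"
      if "S e z = 0" "S e w = 0" "S e u = 0" "S e v = 0" for z w u v
    proof -
      \<comment> \<open>Substituting q = -c S into \<open>KN\<close> makes the two terms on each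
        side equal, whence the factor 2.\<close>
      have "c * (2 * (S z w * S u v)) = c * (2 * (S z u * S w v))"
        using KN[of z w u v] on_perp that by (simp add: algebra_simps)
      then show ?thesis using \<open>c \<noteq> 0\<close> by simp
    qed
    obtain a b where ab: "S e a = 0" "S e b = 0" "S a b \<noteq> 0"
      using no_factor[of "\<lambda>_. 0" "\<lambda>_. 0"] by (auto simp: linear_zero)
    \<comment> \<open>Fixing one nonzero value \<open>S a b\<close> exhibits a factorisation of rank
      one.\<close>
    have "S u v = S b v * (S a u / S a b)" if "S e u = 0" "S e v = 0" for u v
      using SS[of a b u v] that ab by (simp add: field_simps)
    then show False using no_factor[OF lin[of b], of "\<lambda>u. S a u / S a b"] by blast
  qed
  then have qee: "q e e = 0" using e by (simp add: c_def)
  have qe_perp: "q z e = 0" if z: "S e z = 0" for z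
  proof (rule ccontr)
    assume nz: "q z e \<noteq> 0"
    have "q z e * S u v = q v e * S z u" if "S e u = 0" "S e v = 0" for u v
      using KN[of z e u v] on_perp[of z u] on_perp[of u v] that z c0 q(2)[of v e] S(2)[of z e] by simp
    then have "S u v = q v e * (S z u / q z e)" if "S e u = 0" "S e v = 0" for u v
      using that nz by (simp add: field_simps)
    then show False using no_factor[OF q(1)[of e], of "\<lambda>u. S z u / q z e"] by blast
  qed
  have "q z e = 0" for z
    using qe_perp[OF SP[of z]] qee qsub[of z "- S e z / S e e" e e] by (simp add: P_def)
  then show ?thesis using KN[of z w e e] e qee q(2)[of e] by simp
qed

section \<open>Smooth functions\<close>

text \<open>\<open>frechet_derivative\<close> is a choice among the derivatives at a point.
  Functions that agree near the point have the same derivatives there, so the choices coincide even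
  if none exists.\<close>

lemma frechet_derivative_cong_open:
  assumes "open S" "x \<in> S" "\<And>y. y \<in> S \<Longrightarrow> f y = g y"
  shows "frechet_derivative f (at x) = frechet_derivative g (at x)"
proof -
  have "(f has_derivative f') (at x) = (g has_derivative f') (at x)" for f'
    using assms by (metis has_derivative_transform_within_open)
  then show ?thesis by (simp add: frechet_derivative_def)
qed

lemma differentiable_cong_open:
  assumes "open S" "x \<in> S" "\<And>y. y \<in> S \<Longrightarrow> f y = g y" "f differentiable (at x)"
  shows "g differentiable (at x)"
  using assms unfolding differentiable_def by (metis has_derivative_transform_within_open)

lemma iter_deriv_cong_open:
  assumes "open S" "\<And>y. y \<in> S \<Longrightarrow> f y = g y" "x \<in> S"
  shows "iter_deriv vs f x = iter_deriv vs g x"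
  using assms(3)
proof (induction vs arbitrary: x)
  case (Cons v vs)
  then show ?case
    using frechet_derivative_cong_open[OF assms(1) Cons.prems, of "iter_deriv vs f" "iter_deriv vs g"] by simp
qed (simp add: assms(2))

lemma iter_deriv_append: "iter_deriv (vs @ ws) f = iter_deriv vs (iter_deriv ws f)"
  by (induction vs) auto

lemma smooth_on_differentiable: "smooth_on S f \<Longrightarrow> x \<in> S \<Longrightarrow> f differentiable (at x)"
  unfolding smooth_on_def by (metis iter_deriv.simps(1))

lemma smooth_on_iter_deriv: "smooth_on S f \<Longrightarrow> smooth_on S (iter_deriv ws f)"
  unfolding smooth_on_def by (metis iter_deriv_append)

lemma smooth_on_frechet_derivative:
  "smooth_on S f \<Longrightarrow> smooth_on S (\<lambda>x. frechet_derivative f (at x) v)"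
  using smooth_on_iter_deriv[of S f "[v]"] by simp

lemma smooth_on_subset: "smooth_on S f \<Longrightarrow> T \<subseteq> S \<Longrightarrow> smooth_on T f"
  unfolding smooth_on_def by blast

lemma frechet_derivative_has_derivative:
  "f differentiable (at x) \<Longrightarrow> (f has_derivative (\<lambda>v. frechet_derivative f (at x) v)) (at x)"
  by (simp add: frechet_derivative_works)

lemma frechet_derivative_eqI:
  "(f has_derivative f') (at x) \<Longrightarrow> frechet_derivative f (at x) v = f' v"
  by (metis frechet_derivative_at)

lemma iter_deriv_const: "iter_deriv vs (\<lambda>_. c) = (\<lambda>_. if vs = [] then c else 0)"
  by (induction vs) auto

section \<open>Closure properties of smooth functions\<close>

text \<open>A class of differentiable functions closed under directional derivatives consists of
  smooth functions. Closure is asked up to equality on \<open>S\<close>, because derivative formulas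
  hold only there. The induction is from the right, since the last entry of the list is the
  derivative taken first.\<close>

lemma smooth_on_coinduct:
  assumes "open S" "P f" and diff: "\<And>f x. P f \<Longrightarrow> x \<in> S \<Longrightarrow> f differentiable (at x)"
    and step: "\<And>f v. P f \<Longrightarrow> \<exists>g. P g \<and> (\<forall>x\<in>S. frechet_derivative f (at x) v = g x)"
  shows "smooth_on S f"
  unfolding smooth_on_def
proof
  fix vs
  show "\<forall>x\<in>S. iter_deriv vs f differentiable (at x)"
    using assms(2)
  proof (induction vs arbitrary: f rule: rev_induct)
    case Nil
    then show ?case using diff by simp
  next
    case (snoc v vs)
    then obtain g where "P g" and g: "\<And>x. x \<in> S \<Longrightarrow> g x = iter_deriv [v] f x"
      using step[of f v] by auto
    then have "iter_deriv vs g x = iter_deriv (vs @ [v]) f x" if "x \<in> S" for x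
      unfolding iter_deriv_append using iter_deriv_cong_open[OF assms(1)] that by blast
    then show ?case
      using snoc.IH[OF \<open>P g\<close>] differentiable_cong_open[OF assms(1)] by blast
  qed
qed

lemma smooth_on_const: "smooth_on S (\<lambda>_. c)"
  by (simp add: smooth_on_def iter_deriv_const)

lemma smooth_on_add:
  assumes "open S" "smooth_on S f" "smooth_on S g"
  shows "smooth_on S (\<lambda>y. f y + g y)"
proof (rule smooth_on_coinduct[OF assms(1), where
      P = "\<lambda>h. \<exists>f g. smooth_on S f \<and> smooth_on S g \<and> h = (\<lambda>y. f y + g y)"], goal_cases)
  case 1
  then show ?case using assms by blast
next
  case 2
  then show ?case by (auto intro: differentiable_add smooth_on_differentiable)
next
  case (3 h v)
  then obtain f g where fg: "smooth_on S f" "smooth_on S g" "h = (\<lambda>y. f y + g y)" by blast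
  have "frechet_derivative h (at x) v = frechet_derivative f (at x) v + frechet_derivative g (at x) v"
    if "x \<in> S" for x
    unfolding fg(3) by (rule frechet_derivative_eqI)
      (auto intro!: has_derivative_add frechet_derivative_has_derivative fg(1,2)[THEN smooth_on_differentiable] that)
  then show ?case using fg(1,2)[THEN smooth_on_frechet_derivative, of v] by blast
qed

lemma smooth_on_sum:
  assumes "open S" "\<And>i. i \<in> I \<Longrightarrow> smooth_on S (f i)"
  shows "smooth_on S (\<lambda>y. \<Sum>i\<in>I. f i y)"
  using assms(2)
  by (induction I rule: infinite_finite_induct) (auto intro: smooth_on_const smooth_on_add[OF assms(1)])

text \<open>Unlike the products themselves, their sums are closed under differentiation, so coinduction
  applies.\<close>

inductive sum_of_smooth_products ::
  "'a::real_normed_vector set \<Rightarrow> ('a \<Rightarrow> real) \<Rightarrow> bool" for S where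
  mult: "smooth_on S f \<Longrightarrow> smooth_on S g \<Longrightarrow> sum_of_smooth_products S (\<lambda>y. f y * g y)"
| add: "sum_of_smooth_products S f \<Longrightarrow> sum_of_smooth_products S g \<Longrightarrow>
    sum_of_smooth_products S (\<lambda>y. f y + g y)"

lemma sum_of_smooth_products_differentiable:
  "sum_of_smooth_products S f \<Longrightarrow> x \<in> S \<Longrightarrow> f differentiable (at x)"
  by (induction rule: sum_of_smooth_products.induct)
    (auto intro: differentiable_mult differentiable_add smooth_on_differentiable)

lemma smooth_on_mult:
  fixes f g :: "'a::real_normed_vector \<Rightarrow> real"
  assumes "open S" "smooth_on S f" "smooth_on S g"
  shows "smooth_on S (\<lambda>y. f y * g y)"
proof (rule smooth_on_coinduct[OF assms(1), where P = "sum_of_smooth_products S"])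
  show "sum_of_smooth_products S (\<lambda>y. f y * g y)"
    using assms(2,3) by (rule sum_of_smooth_products.mult)
next
  show "h differentiable (at x)" if "sum_of_smooth_products S h" "x \<in> S" for h x
    using that by (rule sum_of_smooth_products_differentiable)
next
  fix h v
  assume "sum_of_smooth_products S h"
  then show "\<exists>g. sum_of_smooth_products S g \<and> (\<forall>x\<in>S. frechet_derivative h (at x) v = g x)"
  proof induction
    case (mult f g)
    have "frechet_derivative (\<lambda>y. f y * g y) (at x) v =
        f x * frechet_derivative g (at x) v + frechet_derivative f (at x) v * g x" if "x \<in> S" for x
      by (rule frechet_derivative_eqI)
        (auto intro!: has_derivative_mult frechet_derivative_has_derivative mult[THEN smooth_on_differentiable] that)
    moreover have "sum_of_smooth_products S
        (\<lambda>x. f x * frechet_derivative g (at x) v + frechet_derivative f (at x) v * g x)"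
      by (intro sum_of_smooth_products.intros smooth_on_frechet_derivative mult)
    ultimately show ?case by blast
  next
    case (add f g)
    then obtain f' g' where "sum_of_smooth_products S f'" "sum_of_smooth_products S g'"
      and eq: "\<And>x. x \<in> S \<Longrightarrow> frechet_derivative f (at x) v = f' x"
        "\<And>x. x \<in> S \<Longrightarrow> frechet_derivative g (at x) v = g' x" by blast
    moreover have "frechet_derivative (\<lambda>y. f y + g y) (at x) v = f' x + g' x" if "x \<in> S" for x
      unfolding eq[OF that, symmetric] by (rule frechet_derivative_eqI)
        (auto intro!: has_derivative_add frechet_derivative_has_derivative
          sum_of_smooth_products_differentiable add that)
    ultimately show ?case
      by (intro exI[of _ "\<lambda>x. f' x + g' x"]) (simp add: sum_of_smooth_products.add)
  qed
qed

lemma smooth_on_prod: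
  fixes f :: "'i \<Rightarrow> 'a::real_normed_vector \<Rightarrow> real"
  assumes "open S" "\<And>i. i \<in> I \<Longrightarrow> smooth_on S (f i)"
  shows "smooth_on S (\<lambda>y. \<Prod>i\<in>I. f i y)"
  using assms(2)
  by (induction I rule: infinite_finite_induct) (auto intro: smooth_on_const smooth_on_mult[OF assms(1)])

lemma smooth_on_bounded_linear:
  assumes "open S" "smooth_on S f" "bounded_linear L"
  shows "smooth_on S (\<lambda>y. L (f y))"
proof (rule smooth_on_coinduct[OF assms(1), where P = "\<lambda>h. \<exists>f. smooth_on S f \<and> h = (\<lambda>y. L (f y))"],
    goal_cases)
  case 1
  then show ?case using assms by blast
next
  case (2 h x)
  then show ?case
    using bounded_linear.has_derivative[OF assms(3)] smooth_on_differentiable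
    unfolding differentiable_def by metis
next
  case (3 h v)
  then obtain f where f: "smooth_on S f" "h = (\<lambda>y. L (f y))" by blast
  have "frechet_derivative h (at x) v = L (frechet_derivative f (at x) v)" if "x \<in> S" for x
    unfolding f(2) by (rule frechet_derivative_eqI)
      (auto intro!: bounded_linear.has_derivative[OF assms(3)] frechet_derivative_has_derivative
        f(1)[THEN smooth_on_differentiable] that)
  then show ?case using f(1)[THEN smooth_on_frechet_derivative, of v] by blast
qed

lemma smooth_on_vec:
  fixes f :: "'n::finite \<Rightarrow> 'a::real_normed_vector \<Rightarrow> real"
  assumes "open S" "\<And>i. smooth_on S (f i)"
  shows "smooth_on S (\<lambda>y. \<chi> i. f i y)"
proof -
  have "smooth_on S (\<lambda>y. \<Sum>i\<in>UNIV. f i y *\<^sub>R axis i (1::real))"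
    by (intro smooth_on_sum smooth_on_bounded_linear[OF assms(1) assms(2)] assms(1)
        bounded_linear_scaleR_left)
  moreover have "(\<Sum>i\<in>UNIV. f i y *\<^sub>R axis i (1::real)) = (\<chi> i. f i y)" for y
    by (simp add: vec_eq_iff axis_def if_distrib[of "(*) _"] cong: if_cong)
  ultimately show ?thesis by simp
qed

lemma smooth_on_det:
  fixes M :: "'a::real_normed_vector \<Rightarrow> real ^ 'n ^ 'n"
  assumes "open S" "\<And>i j. smooth_on S (\<lambda>y. M y $ i $ j)"
  shows "smooth_on S (\<lambda>y. det (M y))"
  unfolding det_def
  by (intro smooth_on_sum smooth_on_mult smooth_on_prod smooth_on_const assms)

section \<open>Symmetry of second derivatives\<close>

text \<open>The mean value theorem in direction \<open>v\<close> reduces the second difference to a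
  difference of two values of the derivative along \<open>v\<close>; differentiability of that
  derivative at the single point \<open>x\<close> then gives the limit.\<close>

lemma second_difference_quotient_tendsto:
  fixes f :: "'a::real_normed_vector \<Rightarrow> real"
  assumes "open S" "x \<in> S" "\<And>y. y \<in> S \<Longrightarrow> f differentiable (at y)"
    and f': "((\<lambda>y. frechet_derivative f (at y) v) has_derivative f') (at x)"
  shows "((\<lambda>t. (f (x + t *\<^sub>R v + t *\<^sub>R w) - f (x + t *\<^sub>R v) - f (x + t *\<^sub>R w) + f x) / t\<^sup>2)
    \<longlongrightarrow> f' w) (at_right 0)"
proof (rule tendstoI)
  fix e :: real assume "e > 0"
  define D where "D y = frechet_derivative f (at y) v" for y
  \<comment> \<open>For s and a in [0, t] the vector s v + a w has norm at most t K; the summand 1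
    keeps \<open>K\<close> positive when \<open>v\<close> and \<open>w\<close> vanish.\<close>
  define K where "K = norm v + norm w + 1"
  have "K > 0" by (simp add: K_def add_nonneg_pos)
  \<comment> \<open>\<open>D\<close> is approximated linearly twice, each time with error at most
    \<epsilon> t K; this choice makes the total t e / 2.\<close>
  define \<epsilon> where "\<epsilon> = e / (4 * K)"
  have "\<epsilon> > 0" using \<open>e > 0\<close> \<open>K > 0\<close> by (simp add: \<epsilon>_def)
  then obtain d where "d > 0"
    and d: "\<And>y. norm (y - x) < d \<Longrightarrow> norm (D y - D x - f' (y - x)) \<le> \<epsilon> * norm (y - x)"
    using f' unfolding has_derivative_at_alt D_def by blast
  obtain r where "r > 0" and r: "ball x r \<subseteq> S" using assms(1,2) open_contains_ball by blast
  have lin: "linear f'" using f' has_derivative_linear by blast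
  have "dist ((f (x + t *\<^sub>R v + t *\<^sub>R w) - f (x + t *\<^sub>R v) - f (x + t *\<^sub>R w) + f x) / t\<^sup>2) (f' w) < e"
    if t: "0 < t" "t < min d r / K" for t
  proof -
    \<comment> \<open>The bound on \<open>t\<close> keeps the displaced points in \<open>S\<close>
      and where the linear approximation of \<open>D\<close> is valid.\<close>
    have tK: "t * K < d" "t * K < r" using t \<open>K > 0\<close> by (simp_all add: field_simps)
    have small: "norm (s *\<^sub>R v + a *\<^sub>R w) \<le> t * K" if "0 \<le> s" "s \<le> t" "0 \<le> a" "a \<le> t" for s a
    proof -
      have "norm (s *\<^sub>R v + a *\<^sub>R w) \<le> s * norm v + a * norm w"
        using norm_triangle_ineq[of "s *\<^sub>R v" "a *\<^sub>R w"] that by simp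
      also have "\<dots> \<le> t * norm v + t * norm w"
        using that by (intro add_mono mult_right_mono) auto
      also have "\<dots> \<le> t * K" using t by (simp add: K_def algebra_simps)
      finally show ?thesis .
    qed
    have inS: "x + s *\<^sub>R v + a *\<^sub>R w \<in> S" if "0 \<le> s" "s \<le> t" "0 \<le> a" "a \<le> t" for s a
      using small[OF that] tK(2) r by (auto simp: dist_norm norm_minus_commute add.assoc subset_iff)
    have D_est: "\<bar>D (x + s *\<^sub>R v + a *\<^sub>R w) - D x - s * f' v - a * f' w\<bar> \<le> \<epsilon> * (t * K)"
      if "0 \<le> s" "s \<le> t" "0 \<le> a" "a \<le> t" for s a
    proof -
      have "\<bar>D (x + s *\<^sub>R v + a *\<^sub>R w) - D x - f' (s *\<^sub>R v + a *\<^sub>R w)\<bar> \<le> \<epsilon> * norm (s *\<^sub>R v + a *\<^sub>R w)"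
        using d[of "x + s *\<^sub>R v + a *\<^sub>R w"] small[OF that] tK(1) by (simp add: add.assoc)
      also have "\<dots> \<le> \<epsilon> * (t * K)" using small[OF that] \<open>\<epsilon> > 0\<close> by simp
      finally show ?thesis using lin by (simp add: linear_add linear_cmul)
    qed
    have der: "((\<lambda>s. f (x + s *\<^sub>R v + a *\<^sub>R w)) has_real_derivative D (x + s *\<^sub>R v + a *\<^sub>R w)) (at s)"
      if "0 \<le> s" "s \<le> t" "0 \<le> a" "a \<le> t" for s a
    proof -
      let ?y = "x + s *\<^sub>R v + a *\<^sub>R w"
      have fd: "(f has_derivative frechet_derivative f (at ?y)) (at ?y)"
        using assms(3)[OF inS[OF that]] frechet_derivative_works by blast
      have "((\<lambda>s. x + s *\<^sub>R v + a *\<^sub>R w) has_derivative (\<lambda>h. h *\<^sub>R v)) (at s)"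
        by (auto intro!: derivative_eq_intros)
      from has_derivative_compose[OF this fd]
      have "((\<lambda>s. f (x + s *\<^sub>R v + a *\<^sub>R w)) has_derivative
          (\<lambda>h. h * D ?y)) (at s)"
        using linear_cmul[OF has_derivative_linear[OF fd]] by (simp add: D_def)
      then show ?thesis
        by (simp add: has_field_derivative_def mult_commute_abs)
    qed
    \<comment> \<open>The increment of \<open>g\<close> is the second difference. In the two values
      of \<open>D\<close> that the mean value theorem produces, the common part \<xi> f'(v) cancels
      and t f'(w) remains.\<close>
    define g where "g s = f (x + s *\<^sub>R v + t *\<^sub>R w) - f (x + s *\<^sub>R v)" for s
    have "\<exists>\<xi>. 0 < \<xi> \<and> \<xi> < t \<and> g t - g 0 = (t - 0) * (D (x + \<xi> *\<^sub>R v + t *\<^sub>R w) - D (x + \<xi> *\<^sub>R v + 0 *\<^sub>R w))"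
      unfolding g_def using t der[of _ t] der[of _ 0]
      by (intro MVT2) (auto intro!: DERIV_diff)
    then obtain \<xi> where \<xi>: "0 < \<xi>" "\<xi> < t"
      and g: "g t - g 0 = t * (D (x + \<xi> *\<^sub>R v + t *\<^sub>R w) - D (x + \<xi> *\<^sub>R v + 0 *\<^sub>R w))" by auto
    let ?q = "(D (x + \<xi> *\<^sub>R v + t *\<^sub>R w) - D (x + \<xi> *\<^sub>R v + 0 *\<^sub>R w)) / t"
    have "(f (x + t *\<^sub>R v + t *\<^sub>R w) - f (x + t *\<^sub>R v) - f (x + t *\<^sub>R w) + f x) / t\<^sup>2 = (g t - g 0) / t\<^sup>2"
      by (simp add: g_def algebra_simps)
    also have "\<dots> = ?q"
      unfolding g using t(1) by (simp add: power2_eq_square)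
    finally have quot: "(f (x + t *\<^sub>R v + t *\<^sub>R w) - f (x + t *\<^sub>R v) - f (x + t *\<^sub>R w) + f x) / t\<^sup>2 = ?q" .
    have "\<bar>D (x + \<xi> *\<^sub>R v + t *\<^sub>R w) - D (x + \<xi> *\<^sub>R v + 0 *\<^sub>R w) - t * f' w\<bar> \<le> 2 * (\<epsilon> * (t * K))"
      using D_est[of \<xi> t] D_est[of \<xi> 0] \<xi> t(1) by simp
    also have "\<dots> = t * (e / 2)" using \<open>K > 0\<close> by (simp add: \<epsilon>_def)
    also have "\<dots> < t * e" using t(1) \<open>e > 0\<close> by simp
    finally have "\<bar>D (x + \<xi> *\<^sub>R v + t *\<^sub>R w) - D (x + \<xi> *\<^sub>R v + 0 *\<^sub>R w) - t * f' w\<bar> < t * e" .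
    moreover have "X - t * Y = t * (X / t - Y)" for X Y
      using t(1) by (simp add: right_diff_distrib)
    ultimately have "t * \<bar>?q - f' w\<bar> < t * e"
      using t(1) by (simp only: abs_mult abs_of_pos)
    then show ?thesis using t(1) by (simp add: quot dist_real_def)
  qed
  moreover have "min d r / K > 0" using \<open>d > 0\<close> \<open>r > 0\<close> \<open>K > 0\<close> by simp
  ultimately show "\<forall>\<^sub>F t in at_right 0.
      dist ((f (x + t *\<^sub>R v + t *\<^sub>R w) - f (x + t *\<^sub>R v) - f (x + t *\<^sub>R w) + f x) / t\<^sup>2) (f' w) < e"
    unfolding eventually_at_right_field by blast
qed

text \<open>The second difference is symmetric in \<open>v\<close> and \<open>w\<close>, so both
  mixed derivatives are limits of the same quotient.\<close>

lemma iter_deriv_swap_real: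
  fixes f :: "'a::real_normed_vector \<Rightarrow> real"
  assumes "open S" "smooth_on S f" "x \<in> S"
  shows "iter_deriv [w, v] f x = iter_deriv [v, w] f x"
proof -
  have lim: "((\<lambda>t. (f (x + t *\<^sub>R v + t *\<^sub>R w) - f (x + t *\<^sub>R v) - f (x + t *\<^sub>R w) + f x) / t\<^sup>2)
      \<longlongrightarrow> iter_deriv [w, v] f x) (at_right 0)" for v w
    using second_difference_quotient_tendsto[OF assms(1,3) smooth_on_differentiable[OF assms(2)]
        frechet_derivative_has_derivative[OF smooth_on_differentiable[OF smooth_on_frechet_derivative[OF assms(2)] assms(3)]]]
    by simp
  have "((\<lambda>t. (f (x + t *\<^sub>R v + t *\<^sub>R w) - f (x + t *\<^sub>R v) - f (x + t *\<^sub>R w) + f x) / t\<^sup>2)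
      \<longlongrightarrow> iter_deriv [v, w] f x) (at_right 0)"
    using lim[where v = w and w = v] by (simp add: algebra_simps)
  then show ?thesis using lim tendsto_unique trivial_limit_at_right_real by blast
qed

lemma iter_deriv_bounded_linear:
  assumes "open S" "smooth_on S f" "bounded_linear L" "x \<in> S"
  shows "iter_deriv vs (\<lambda>y. L (f y)) x = L (iter_deriv vs f x)"
  using assms(4)
proof (induction vs arbitrary: x)
  case (Cons v vs)
  have "frechet_derivative (iter_deriv vs (\<lambda>y. L (f y))) (at x) v =
      frechet_derivative (\<lambda>y. L (iter_deriv vs f y)) (at x) v"
    using frechet_derivative_cong_open[OF assms(1) Cons.prems Cons.IH] by simp
  also have "\<dots> = L (iter_deriv (v # vs) f x)"
    using assms(2) Cons.prems
    by (intro frechet_derivative_eqI)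
      (auto simp: smooth_on_def intro!: bounded_linear.has_derivative[OF assms(3)] frechet_derivative_has_derivative)
  finally show ?case by simp
qed simp

lemma iter_deriv_swap:
  fixes f :: "'a::real_normed_vector \<Rightarrow> 'b::euclidean_space"
  assumes "open S" "smooth_on S f" "x \<in> S"
  shows "iter_deriv [w, v] f x = iter_deriv [v, w] f x"
proof (rule euclidean_eqI)
  fix b :: 'b
  show "iter_deriv [w, v] f x \<bullet> b = iter_deriv [v, w] f x \<bullet> b"
    using iter_deriv_swap_real[OF assms(1) smooth_on_bounded_linear[OF assms(1,2) bounded_linear_inner_left] assms(3)]
      iter_deriv_bounded_linear[OF assms(1,2) bounded_linear_inner_left assms(3)]
    by metis
qed

section \<open>Product rules for fields of linear and bilinear maps\<close>

text \<open>Expanding the argument in the finite basis reduces the rule to products of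
  differentiable functions, so differentiability of \<open>a\<close> at each fixed argument is
  enough.\<close>

lemma has_derivative_apply_linear:
  fixes a :: "'a::real_normed_vector \<Rightarrow> 'b::euclidean_space \<Rightarrow> 'c::real_normed_vector"
  assumes "open S" "p \<in> S" "\<And>y. y \<in> S \<Longrightarrow> linear (a y)"
    and "\<And>u. ((\<lambda>y. a y u) has_derivative (\<lambda>w. a' w u)) (at p)"
    and "(U has_derivative U') (at p)"
  shows "((\<lambda>y. a y (U y)) has_derivative (\<lambda>w. a' w (U p) + a p (U' w))) (at p)"
proof -
  have expand: "a y u = (\<Sum>i\<in>Basis. (u \<bullet> i) *\<^sub>R a y i)" if "y \<in> S" for y u
    by (metis (no_types, lifting) assms(3)[OF that] euclidean_representation linear_cmul linear_sum sum.cong)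
  have deriv: "((\<lambda>y. \<Sum>i\<in>Basis. (V y \<bullet> i) *\<^sub>R a y i) has_derivative
      (\<lambda>w. \<Sum>i\<in>Basis. (V p \<bullet> i) *\<^sub>R a' w i + (V' w \<bullet> i) *\<^sub>R a p i)) (at p)"
    if "(V has_derivative V') (at p)" for V V'
    by (auto intro!: has_derivative_sum has_derivative_scaleR has_derivative_inner_left that assms(4))
  have deriv': "((\<lambda>y. a y (V y)) has_derivative
      (\<lambda>w. (\<Sum>i\<in>Basis. (V p \<bullet> i) *\<^sub>R a' w i) + a p (V' w))) (at p)"
    if "(V has_derivative V') (at p)" for V V'
  proof -
    have "((\<lambda>y. a y (V y)) has_derivative
        (\<lambda>w. \<Sum>i\<in>Basis. (V p \<bullet> i) *\<^sub>R a' w i + (V' w \<bullet> i) *\<^sub>R a p i)) (at p)"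
      by (rule has_derivative_transform_within_open[OF deriv[OF that] assms(1,2)]) (rule expand[symmetric])
    then show ?thesis
      by (simp only: sum.distrib expand[OF assms(2), symmetric])
  qed
  \<comment> \<open>Linearity of \<open>a' w\<close> is not among the hypotheses; comparing the
    expansion for the constant argument \<open>U p\<close> with the given derivative identifies the
    sum.\<close>
  have "(\<Sum>i\<in>Basis. (U p \<bullet> i) *\<^sub>R a' w i) = a' w (U p)" for w
    using has_derivative_unique[OF deriv'[OF has_derivative_const[of "U p"]] assms(4)[of "U p"]]
      linear_0[OF assms(3)[OF assms(2)]] by (simp add: fun_eq_iff)
  then show ?thesis using deriv'[OF assms(5)] by simp
qed

lemma linear_frechet_derivative:
  "f differentiable (at x) \<Longrightarrow> linear (frechet_derivative f (at x))"
  using frechet_derivative_works has_derivative_linear by blast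

lemma has_derivative_apply_bilinear:
  fixes b :: "'a::real_normed_vector \<Rightarrow> 'b::euclidean_space \<Rightarrow> 'c::euclidean_space \<Rightarrow> 'd::real_normed_vector"
  assumes "open S" "p \<in> S" "\<And>y. y \<in> S \<Longrightarrow> bilinear (b y)"
    and b': "\<And>u v. ((\<lambda>y. b y u v) has_derivative (\<lambda>w. b' w u v)) (at p)"
    and "(U has_derivative U') (at p)" "(V has_derivative V') (at p)"
  shows "((\<lambda>y. b y (U y) (V y)) has_derivative
    (\<lambda>w. b' w (U p) (V p) + b p (U' w) (V p) + b p (U p) (V' w))) (at p)"
proof (rule has_derivative_apply_linear[OF assms(1,2) _ _ assms(6)])
  show "linear (b y (U y))" if "y \<in> S" for y
    using assms(3)[OF that] by (simp add: bilinear_def)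
  show "((\<lambda>y. b y (U y) v) has_derivative (\<lambda>w. b' w (U p) v + b p (U' w) v)) (at p)" for v
  proof (rule has_derivative_apply_linear[OF assms(1,2) _ _ assms(5)])
    show "linear (\<lambda>u. b y u v)" if "y \<in> S" for y
      using assms(3)[OF that] by (simp add: bilinear_def)
  qed (rule b')
qed

text \<open>The identities of bilinearity hold on the open set \<open>T\<close> and can therefore be
  differentiated. This makes first derivatives of a form field admissible in the product
  rules.\<close>

lemma bilinear_frechet_derivative:
  assumes "open T" "y \<in> T" and bil: "\<And>z. z \<in> T \<Longrightarrow> bilinear (h z)"
    and diff: "\<And>u v. (\<lambda>z. h z u v) differentiable (at y)"
  shows "bilinear (\<lambda>u v. frechet_derivative (\<lambda>z. h z u v) (at y) w)"
proof -
  note D = frechet_derivative_has_derivative[OF diff]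
  note cong = frechet_derivative_cong_open[OF assms(1,2)]
  have "frechet_derivative (\<lambda>z. h z (u + u') v) (at y) w =
      frechet_derivative (\<lambda>z. h z u v) (at y) w + frechet_derivative (\<lambda>z. h z u' v) (at y) w" for u u' v
    using cong[of "\<lambda>z. h z (u + u') v" "\<lambda>z. h z u v + h z u' v"]
      frechet_derivative_eqI[OF has_derivative_add[OF D[of u v] D[of u' v]], of w] bil
    by (simp add: bilinear_ladd)
  moreover have "frechet_derivative (\<lambda>z. h z u (v + v')) (at y) w =
      frechet_derivative (\<lambda>z. h z u v) (at y) w + frechet_derivative (\<lambda>z. h z u v') (at y) w" for u v v'
    using cong[of "\<lambda>z. h z u (v + v')" "\<lambda>z. h z u v + h z u v'"]
      frechet_derivative_eqI[OF has_derivative_add[OF D[of u v] D[of u v']], of w] bil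
    by (simp add: bilinear_radd)
  moreover have "frechet_derivative (\<lambda>z. h z (r *\<^sub>R u) v) (at y) w =
      r *\<^sub>R frechet_derivative (\<lambda>z. h z u v) (at y) w" for r u v
    using cong[of "\<lambda>z. h z (r *\<^sub>R u) v" "\<lambda>z. r *\<^sub>R h z u v"]
      frechet_derivative_eqI[OF has_derivative_scaleR_right[OF D[of u v]], of r w] bil
    by (simp add: bilinear_lmul)
  moreover have "frechet_derivative (\<lambda>z. h z u (r *\<^sub>R v)) (at y) w =
      r *\<^sub>R frechet_derivative (\<lambda>z. h z u v) (at y) w" for r u v
    using cong[of "\<lambda>z. h z u (r *\<^sub>R v)" "\<lambda>z. r *\<^sub>R h z u v"]
      frechet_derivative_eqI[OF has_derivative_scaleR_right[OF D[of u v]], of r w] bil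
    by (simp add: bilinear_rmul)
  ultimately show ?thesis
    by (auto simp: bilinear_def intro!: linearI)
qed

section \<open>The isometry equations on jets\<close>

text \<open>The three terms come from the base point \<open>F y\<close>, by the chain rule with
  fixed arguments, and from the two moving arguments.\<close>

lemma pullback_has_derivative:
  fixes F :: "real ^ 'n \<Rightarrow> real ^ 'n" and h :: "'n::finite form_field"
  assumes "open S" "y \<in> S" "smooth_on S F" "\<And>y. y \<in> S \<Longrightarrow> F y \<in> T"
    and "\<And>z. z \<in> T \<Longrightarrow> bilinear (h z)" "\<And>u v. smooth_on T (\<lambda>z. h z u v)"
  defines "D \<equiv> (\<lambda>v x. frechet_derivative F (at x) v)"
  shows "((\<lambda>y. pullback F h y u v) has_derivative (\<lambda>w.
     frechet_derivative (\<lambda>z. h z (D u y) (D v y)) (at (F y)) (D w y)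
     + h (F y) (frechet_derivative (D u) (at y) w) (D v y)
     + h (F y) (D u y) (frechet_derivative (D v) (at y) w))) (at y)"
  unfolding pullback_def D_def
  apply (rule has_derivative_apply_bilinear[OF assms(1,2), where b = "\<lambda>y. h (F y)"
      and b' = "\<lambda>w a c. frechet_derivative (\<lambda>z. h z a c) (at (F y)) (frechet_derivative F (at y) w)"])
     apply (simp add: assms)
    apply (rule has_derivative_compose[of F])
     apply (auto intro!: frechet_derivative_has_derivative smooth_on_differentiable[OF smooth_on_frechet_derivative[OF assms(3)]]
      smooth_on_differentiable[OF assms(6)] smooth_on_differentiable[OF assms(3)] assms(2,4))
  done

text \<open>These are the first and second derivatives at \<open>p\<close> of the pullback of
  \<open>h\<close> minus \<open>h\<close>. As \<open>F\<close> fixes \<open>p\<close> with identity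
  differential, the second derivatives of \<open>h\<close> cancel between the two.\<close>

lemma isometry_jet_equations:
  fixes F :: "real ^ 'n \<Rightarrow> real ^ 'n" and h :: "'n::finite form_field"
  assumes S: "open S" "p \<in> S" "smooth_on S F" "\<And>y. y \<in> S \<Longrightarrow> F y \<in> T"
    and T: "open T" "\<And>z. z \<in> T \<Longrightarrow> bilinear (h z)" "\<And>u v. smooth_on T (\<lambda>z. h z u v)"
    and F: "F p = p" "\<And>v. frechet_derivative F (at p) v = v"
    and iso: "eq_to_order 2 p (\<lambda>y. pullback F h y u v - h y u v) (\<lambda>y. 0)"
  defines "Q \<equiv> \<lambda>z w. iter_deriv [z, w] F p"
    and "C \<equiv> \<lambda>z w u. iter_deriv [z, w, u] F p"
    and "H \<equiv> \<lambda>w a c. frechet_derivative (\<lambda>z. h z a c) (at p) w"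
  shows "h p (Q w u) v + h p u (Q w v) = 0"
    and "H (Q z w) u v + H w (Q z u) v + H w u (Q z v) + H z (Q w u) v + H z u (Q w v)
      + h p (C z w u) v + h p u (C z w v) + h p (Q w u) (Q z v) + h p (Q z u) (Q w v) = 0"
proof -
  define D where "D v x = frechet_derivative F (at x) v" for v x
  define E where "E y = pullback F h y u v - h y u v" for y
  have pT: "p \<in> T" using S(2,4) F(1) by metis
  have DF: "smooth_on S (D v)" for v
    unfolding D_def by (rule smooth_on_frechet_derivative[OF S(3)])
  have DDF: "smooth_on S (\<lambda>y. frechet_derivative (D v) (at y) w)" for v w
    by (rule smooth_on_frechet_derivative[OF DF])
  have Dp: "D v p = v" for v by (simp add: D_def F)
  have Q: "Q z w = frechet_derivative (D w) (at p) z" for z w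
    by (simp add: Q_def D_def[abs_def])
  have C: "C z w u = frechet_derivative (\<lambda>y. frechet_derivative (D u) (at y) w) (at p) z" for z w u
    by (simp add: C_def D_def[abs_def])
  \<comment> \<open>\<open>K\<close> varies with the base point \<open>F y\<close> and with the
    direction \<open>D w y\<close>; the latter produces the term
    \<open>H (Q z w) u v\<close>.\<close>
  define K where "K y a c = frechet_derivative (\<lambda>z. h z a c) (at (F y)) (D w y)" for y a c
  \<comment> \<open>The first derivative is needed as a formula near \<open>p\<close>, since it is
    differentiated again.\<close>
  define E1 where "E1 y = K y (D u y) (D v y) + h (F y) (frechet_derivative (D u) (at y) w) (D v y)
     + h (F y) (D u y) (frechet_derivative (D v) (at y) w)
     - frechet_derivative (\<lambda>z. h z u v) (at y) w" for y
  define R where "R = S \<inter> T"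
  have R: "open R" "p \<in> R" using S T(1) pT by (auto simp: R_def)
  have E1: "frechet_derivative E (at y) w = E1 y" if "y \<in> R" for y
  proof -
    have y: "y \<in> S" "y \<in> T" using that by (auto simp: R_def)
    show ?thesis
      unfolding E_def E1_def K_def D_def
      by (rule frechet_derivative_eqI, rule has_derivative_diff,
          rule pullback_has_derivative[OF S(1) y(1) S(3,4) T(2,3), unfolded D_def], assumption+)
        (auto intro!: frechet_derivative_has_derivative smooth_on_differentiable[OF T(3)] y)
  qed
  have "iter_deriv vs E p = 0" if "length vs \<le> 2" for vs
    using iso that unfolding eq_to_order_def E_def[abs_def, symmetric] by (simp add: iter_deriv_const)
  from this[of "[w]"] this[of "[z, w]"] have zero: "E1 p = 0" "frechet_derivative E1 (at p) z = 0"
    using E1[OF R(2)] frechet_derivative_cong_open[OF R, of "\<lambda>y. frechet_derivative E (at y) w" E1] E1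
    by simp_all
  show "h p (Q w u) v + h p u (Q w v) = 0"
    using zero(1) by (simp add: E1_def K_def F Dp Q)
  have hF: "((\<lambda>y. h (F y) a c) has_derivative (\<lambda>z. H z a c)) (at p)" for a c
  proof -
    have "((\<lambda>z. h z a c) has_derivative (\<lambda>z. H z a c)) (at (F p))"
      unfolding F H_def by (rule frechet_derivative_has_derivative[OF smooth_on_differentiable[OF T(3) pT]])
    from has_derivative_compose[OF frechet_derivative_has_derivative[OF smooth_on_differentiable[OF S(3,2)]] this]
    show ?thesis by (simp add: F)
  qed
  have K': "((\<lambda>y. K y a c) has_derivative
      (\<lambda>z. frechet_derivative (\<lambda>x. frechet_derivative (\<lambda>z. h z a c) (at x) w) (at p) z + H (Q z w) a c)) (at p)"
    for a c
  proof -
    have "((\<lambda>y. frechet_derivative (\<lambda>z. h z a c) (at (F y)) \<xi>) has_derivative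
       (\<lambda>z. frechet_derivative (\<lambda>x. frechet_derivative (\<lambda>z. h z a c) (at x) \<xi>) (at p) z)) (at p)" for \<xi>
    proof -
      have "((\<lambda>x. frechet_derivative (\<lambda>z. h z a c) (at x) \<xi>) has_derivative
         (\<lambda>z. frechet_derivative (\<lambda>x. frechet_derivative (\<lambda>z. h z a c) (at x) \<xi>) (at p) z)) (at (F p))"
        unfolding F
        by (rule frechet_derivative_has_derivative[OF smooth_on_differentiable[OF smooth_on_frechet_derivative[OF T(3)] pT]])
      from has_derivative_compose[OF frechet_derivative_has_derivative[OF smooth_on_differentiable[OF S(3,2)]] this]
      show ?thesis by (simp add: F)
    qed
    from has_derivative_apply_linear[where a = "\<lambda>y \<xi>. frechet_derivative (\<lambda>z. h z a c) (at (F y)) \<xi>"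
        and a' = "\<lambda>z \<xi>. frechet_derivative (\<lambda>x. frechet_derivative (\<lambda>z. h z a c) (at x) \<xi>) (at p) z",
        OF S(1,2) _ this
        frechet_derivative_has_derivative[OF smooth_on_differentiable[OF DF[of w] S(2)]]]
    show ?thesis
      using linear_frechet_derivative[OF smooth_on_differentiable[OF T(3) S(4)]]
      by (simp add: K_def F Dp Q H_def)
  qed
  have Kp: "K p a c = H w a c" for a c by (simp add: K_def F H_def Dp)
  have bilK: "bilinear (K y)" if "y \<in> S" for y
    unfolding K_def[abs_def]
    by (rule bilinear_frechet_derivative[OF T(1) S(4)[OF that] T(2) smooth_on_differentiable[OF T(3) S(4)[OF that]]])
  have bilF: "bilinear (h (F y))" if "y \<in> S" for y
    by (rule T(2)[OF S(4)[OF that]])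
  note D' = frechet_derivative_has_derivative[OF smooth_on_differentiable[OF DF S(2)]]
  note DD' = frechet_derivative_has_derivative[OF smooth_on_differentiable[OF DDF S(2)]]
  have "(E1 has_derivative (\<lambda>z.
      (frechet_derivative (\<lambda>x. frechet_derivative (\<lambda>z. h z (D u p) (D v p)) (at x) w) (at p) z + H (Q z w) (D u p) (D v p)
        + K p (frechet_derivative (D u) (at p) z) (D v p) + K p (D u p) (frechet_derivative (D v) (at p) z))
      + (H z (frechet_derivative (D u) (at p) w) (D v p)
        + h (F p) (frechet_derivative (\<lambda>y. frechet_derivative (D u) (at y) w) (at p) z) (D v p)
        + h (F p) (frechet_derivative (D u) (at p) w) (frechet_derivative (D v) (at p) z))
      + (H z (D u p) (frechet_derivative (D v) (at p) w)
        + h (F p) (frechet_derivative (D u) (at p) z) (frechet_derivative (D v) (at p) w)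
        + h (F p) (D u p) (frechet_derivative (\<lambda>y. frechet_derivative (D v) (at y) w) (at p) z))
      - frechet_derivative (\<lambda>x. frechet_derivative (\<lambda>z. h z u v) (at x) w) (at p) z)) (at p)"
    unfolding E1_def[abs_def]
    by (intro has_derivative_add has_derivative_diff
        has_derivative_apply_bilinear[OF S(1,2) bilK K' D' D']
        has_derivative_apply_bilinear[OF S(1,2) bilF hF DD' D']
        has_derivative_apply_bilinear[OF S(1,2) bilF hF D' DD']
        frechet_derivative_has_derivative[OF smooth_on_differentiable[OF smooth_on_frechet_derivative[OF T(3)] pT]])
  from frechet_derivative_eqI[OF this, of z] zero(2)
  show "H (Q z w) u v + H w (Q z u) v + H w u (Q z v) + H z (Q w u) v + H z u (Q w v)
      + h p (C z w u) v + h p u (C z w v) + h p (Q w u) (Q z v) + h p (Q z u) (Q w v) = 0"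
    by (simp add: Kp Dp F Q C)
qed

section \<open>The characteristic direction field\<close>

lemma subspace_form_kernel: "bilinear b \<Longrightarrow> subspace (form_kernel b)"
  by (auto simp: subspace_def form_kernel_def bilinear_lzero bilinear_ladd bilinear_lmul)

lemma dim_1_nonzero:
  fixes K :: "'a::euclidean_space set"
  assumes "dim K = 1"
  shows "\<exists>n\<in>K. n \<noteq> 0"
  using assms dim_eq_0[of K] by force

lemma dim_1_multiple:
  fixes K :: "'a::euclidean_space set"
  assumes "dim K = 1" "subspace K" "n \<in> K" "n \<noteq> 0" "v \<in> K"
  shows "\<exists>r. v = r *\<^sub>R n"
proof -
  have "span {n} = K"
  proof (rule subspace_dim_equal)
    show "span {n} \<subseteq> K" using assms by (simp add: span_minimal)
    show "dim (span {n}) \<ge> dim K" using assms by (simp add: dim_insert)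
  qed (use assms in auto)
  then show ?thesis using assms(5) by (auto simp: span_singleton)
qed

text \<open>Genericity quantifies over local kernel fields, so it yields information at
  \<open>p\<close> only once such a field around \<open>p\<close> is available.\<close>

lemma exists_kernel_field:
  fixes h :: "'n::finite form_field"
  assumes T: "open T" "p \<in> T" and h: "\<And>y. y \<in> T \<Longrightarrow> lightlike_form (h y)"
    and smooth: "\<And>u v. smooth_on T (\<lambda>y. h y u v)"
  shows "\<exists>W X. open W \<and> p \<in> W \<and> W \<subseteq> T \<and> smooth_on W X \<and>
    (\<forall>y\<in>W. X y \<noteq> 0 \<and> X y \<in> form_kernel (h y))"
proof -
  have bil: "bilinear (h y)" and sym: "h y u v = h y v u" and dim1: "dim (form_kernel (h y)) = 1"
    if "y \<in> T" for y u v
    using h[OF that] by (auto simp: lightlike_form_def)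
  obtain n where n: "n \<in> form_kernel (h p)" "n \<noteq> 0"
    using dim_1_nonzero[OF dim1[OF T(2)]] by blast
  define B where "B y v = (\<chi> i. h y (axis i 1) v)" for y v
  \<comment> \<open>Adding the rank one form of \<open>n\<close> makes \<open>h\<close> nondegenerate near \<open>p\<close>, and the solution of
    \<open>N y X = n\<close> is then a kernel vector. Cramer's rule without its denominator keeps \<open>X\<close> polynomial
    in the entries of \<open>h\<close>.\<close>
  define N where "N y = matrix (\<lambda>v. B y v + (n \<bullet> v) *\<^sub>R n)" for y
  have linB: "linear (B y)" if "y \<in> T" for y
    using bil[OF that] by (auto intro!: linearI simp: B_def vec_eq_iff bilinear_radd bilinear_rmul)
  have hB: "h y u v = u \<bullet> B y v" if "y \<in> T" for y u v
  proof -
    have lin: "linear (\<lambda>u. h y u v)" using bil[OF that] by (simp add: bilinear_def)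
    have "h y u v = h y (\<Sum>i\<in>UNIV. (u $ i) *\<^sub>R axis i 1) v"
      using basis_expansion[of u] by (simp add: scalar_mult_eq_scaleR)
    also have "\<dots> = (\<Sum>i\<in>UNIV. u $ i * h y (axis i 1) v)"
      by (simp add: linear_sum[OF lin] linear_cmul[OF lin])
    finally show ?thesis by (simp add: inner_vec_def B_def)
  qed
  have ker: "v \<in> form_kernel (h y) \<longleftrightarrow> B y v = 0" if "y \<in> T" for y v
    using hB[OF that] sym[OF that] by (auto simp: form_kernel_def) (metis inner_eq_zero_iff)
  have N: "N y *v v = B y v + (n \<bullet> v) *\<^sub>R n" if "y \<in> T" for y v
    unfolding N_def
    by (rule matrix_vector_mul(2)[THEN fun_cong])
      (auto intro!: linearI simp: linear_add[OF linB[OF that]] linear_cmul[OF linB[OF that]]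
        inner_add_right algebra_simps)
  have N_entry: "N y $ i $ j = h y (axis i 1) (axis j 1) + n $ j * n $ i" for y i j
    by (simp add: N_def matrix_def B_def inner_axis)
  have smoothN: "smooth_on T (\<lambda>y. N y $ i $ j)" for i j
    unfolding N_entry by (intro smooth_on_add smooth_on_const smooth T(1))
  define \<Delta> where "\<Delta> y = det (N y)" for y
  define X where "X y = (\<chi> k. det (\<chi> i j. if j = k then n $ i else N y $ i $ j))" for y
  define W where "W = {y \<in> T. \<Delta> y \<noteq> 0}"
  have smooth_\<Delta>: "smooth_on T \<Delta>"
    unfolding \<Delta>_def[abs_def] by (rule smooth_on_det[OF T(1) smoothN])
  then have "continuous_on T \<Delta>"
    using smooth_on_differentiable differentiable_imp_continuous_within
    by (metis continuous_at_imp_continuous_on)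
  then have "open W"
    using continuous_open_preimage[OF _ T(1), of \<Delta> "- {0}"] by (auto simp: W_def Int_def vimage_def)
  \<comment> \<open>Pairing with \<open>n\<close> kills the part \<open>B p v\<close>, because
    \<open>n\<close> is in the kernel, and leaves n . v = 0. Then \<open>v\<close> lies in the
    kernel line as well, hence is a multiple of \<open>n\<close> orthogonal to
    \<open>n\<close>.\<close>
  have "v = 0" if v: "N p *v v = 0" for v
  proof -
    have "n \<bullet> (B p v + (n \<bullet> v) *\<^sub>R n) = 0" using v N[OF T(2)] by simp
    moreover have "n \<bullet> B p v = 0" using n(1) hB[OF T(2)] by (simp add: form_kernel_def)
    ultimately have nv: "n \<bullet> v = 0" using n(2) by (simp add: inner_add_right)
    then have "B p v = 0" using v N[OF T(2)] by simp
    then obtain r where "v = r *\<^sub>R n"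
      using dim_1_multiple[OF dim1[OF T(2)] subspace_form_kernel[OF bil[OF T(2)]] n] ker[OF T(2)] by blast
    then show ?thesis using nv n(2) by simp
  qed
  then have "\<Delta> p \<noteq> 0"
    unfolding \<Delta>_def invertible_det_nz[symmetric] invertible_left_inverse matrix_left_invertible_ker by blast
  then have "p \<in> W" using T(2) by (simp add: W_def)
  have "W \<subseteq> T" by (auto simp: W_def)
  have "X y \<noteq> 0 \<and> X y \<in> form_kernel (h y)" if "y \<in> W" for y
  proof -
    have y: "y \<in> T" "det (N y) \<noteq> 0" using that by (auto simp: W_def \<Delta>_def)
    \<comment> \<open>\<open>N y\<close> sends a kernel vector \<open>k\<close> to a nonzero
      multiple of \<open>n\<close>, so the solution given by Cramer's rule is proportional to
      \<open>k\<close>.\<close>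
    obtain k where k: "k \<in> form_kernel (h y)" "k \<noteq> 0"
      using dim_1_nonzero[OF dim1[OF y(1)]] by blast
    have Nk: "N y *v k = (n \<bullet> k) *\<^sub>R n" using k(1) N[OF y(1)] ker[OF y(1)] by simp
    moreover have "N y *v k \<noteq> 0"
      using y(2) k(2) unfolding invertible_det_nz[symmetric] invertible_left_inverse matrix_left_invertible_ker
      by blast
    ultimately have nk: "n \<bullet> k \<noteq> 0" by auto
    have "N y *v ((1 / (n \<bullet> k)) *\<^sub>R k) = n"
      using Nk nk by (simp add: matrix_vector_mult_scaleR)
    then have "(1 / (n \<bullet> k)) *\<^sub>R k = (\<chi> i. X y $ i / \<Delta> y)"
      unfolding cramer[OF y(2)] by (simp add: X_def \<Delta>_def)
    then have "X y = (\<Delta> y / (n \<bullet> k)) *\<^sub>R k"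
      using y(2) by (simp add: vec_eq_iff \<Delta>_def field_simps)
    then show ?thesis
      using k nk y subspace_scale[OF subspace_form_kernel[OF bil[OF y(1)]]] by (auto simp: \<Delta>_def)
  qed
  moreover have "smooth_on T X"
    unfolding X_def[abs_def]
  proof (intro smooth_on_vec smooth_on_det T(1))
    show "smooth_on T (\<lambda>y. (\<chi> i j. if j = k then n $ i else N y $ i $ j) $ i $ j)" for k i j
      by (cases "j = k") (simp_all add: smooth_on_const smoothN)
  qed
  then have "smooth_on W X" using \<open>W \<subseteq> T\<close> by (rule smooth_on_subset)
  ultimately show ?thesis using \<open>open W\<close> \<open>p \<in> W\<close> \<open>W \<subseteq> T\<close> by blast
qed

text \<open>Differentiating h(X, v) = 0 trades the terms with the derivative of \<open>X\<close> for
  first derivatives of \<open>h\<close>. The result depends on \<open>X\<close> only through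
  \<open>X p\<close>, and is the expression that occurs in the second isometry equation.\<close>

lemma lie_derivative_kernel_field:
  fixes h :: "'n::finite form_field"
  assumes W: "open W" "p \<in> W" and h: "\<And>y. y \<in> W \<Longrightarrow> bilinear (h y)" "\<And>y u v. y \<in> W \<Longrightarrow> h y u v = h y v u"
    and diff: "\<And>u v. (\<lambda>y. h y u v) differentiable (at p)"
    and X: "X differentiable (at p)" "\<And>y. y \<in> W \<Longrightarrow> X y \<in> form_kernel (h y)"
  defines "H \<equiv> \<lambda>w a c. frechet_derivative (\<lambda>z. h z a c) (at p) w"
  shows "lie_derivative X h p u v = H (X p) u v - H u (X p) v - H v (X p) u"
proof -
  have "H w (X p) v + h p (frechet_derivative X (at p) w) v = 0" for w v
  proof -
    have "((\<lambda>y. h y (X y) v) has_derivative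
        (\<lambda>w. H w (X p) v + h p (frechet_derivative X (at p) w) v)) (at p)"
      unfolding H_def
      by (rule has_derivative_apply_linear[OF W _ frechet_derivative_has_derivative[OF diff]
            frechet_derivative_has_derivative[OF X(1)]])
        (use h(1) in \<open>simp add: bilinear_def\<close>)
    moreover have "((\<lambda>y. h y (X y) v) has_derivative (\<lambda>w. 0)) (at p)"
      by (rule has_derivative_transform_within_open[OF has_derivative_const[of 0] W])
        (use X(2) in \<open>simp add: form_kernel_def\<close>)
    ultimately show ?thesis using has_derivative_unique by (metis (no_types, lifting))
  qed
  from this[of u v] this[of v u] show ?thesis
    using h(2)[OF W(2), of u "frechet_derivative X (at p) v"]
    by (simp add: lie_derivative_def H_def)
qed

section \<open>Vanishing of the second-order jet\<close>

lemma second_jet_trivial: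
  fixes F :: "real ^ 'n \<Rightarrow> real ^ 'n" and h :: "'n::finite form_field"
  assumes dim4: "CARD('n) \<ge> 4"
    and S: "open S" "p \<in> S" "smooth_on S F" "\<And>y. y \<in> S \<Longrightarrow> F y \<in> T"
    and T: "open T" "\<And>y. y \<in> T \<Longrightarrow> lightlike_form (h y)" "\<And>u v. smooth_on T (\<lambda>y. h y u v)"
    and generic: "\<And>W X. open W \<Longrightarrow> W \<subseteq> T \<Longrightarrow> smooth_on W X \<Longrightarrow>
        \<forall>y\<in>W. X y \<noteq> 0 \<and> X y \<in> form_kernel (h y) \<Longrightarrow>
        \<forall>y\<in>W. form_kernel (lie_derivative X h y) = form_kernel (h y)"
    and F: "F p = p" "\<And>v. frechet_derivative F (at p) v = v"
    and iso: "\<And>u v. eq_to_order 2 p (\<lambda>y. pullback F h y u v - h y u v) (\<lambda>y. 0)"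
  shows "iter_deriv [z, w] F p = 0"
proof -
  have pT: "p \<in> T" using S(2,4) F(1) by metis
  have bil: "bilinear (h y)" and sym: "h y u v = h y v u" and dim1: "dim (form_kernel (h y)) = 1"
    if "y \<in> T" for y u v
    using T(2)[OF that] by (auto simp: lightlike_form_def)
  obtain W X where W: "open W" "p \<in> W" "W \<subseteq> T" and X: "smooth_on W X"
      "\<forall>y\<in>W. X y \<noteq> 0 \<and> X y \<in> form_kernel (h y)"
    using exists_kernel_field[OF T(1) pT T(2,3)] by blast
  define n where "n = X p"
  have n: "n \<noteq> 0" "n \<in> form_kernel (h p)" using X(2) W(2) by (auto simp: n_def)
  define H where "H w a c = frechet_derivative (\<lambda>z. h z a c) (at p) w" for w a c
  define L where "L = lie_derivative X h p"
  \<comment> \<open>Genericity enters here: the kernel of \<open>L\<close> is a line.\<close>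
  have kerL: "form_kernel L = form_kernel (h p)"
    using generic[OF W(1,3) X] W(2) by (simp add: L_def)
  have hdiff: "(\<lambda>y. h y u v) differentiable (at p)" for u v
    by (rule smooth_on_differentiable[OF T(3) pT])
  have linH: "linear (\<lambda>w. H w a c)" for a c
    unfolding H_def by (rule linear_frechet_derivative[OF hdiff])
  have bilH: "bilinear (H w)" for w
    unfolding H_def[abs_def] by (rule bilinear_frechet_derivative[OF T(1) pT bil hdiff])
  have symH: "H w a c = H w c a" for w a c
    unfolding H_def using frechet_derivative_cong_open[OF T(1) pT, of "\<lambda>z. h z a c" "\<lambda>z. h z c a"] sym by simp
  have L: "L u v = H n u v - H u n v - H v n u" for u v
    unfolding L_def n_def H_def
    by (rule lie_derivative_kernel_field[OF W(1,2) _ _ hdiff])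
      (use W X bil sym smooth_on_differentiable in auto)
  have linHu: "linear (H w a)" and linHu': "linear (\<lambda>a. H w a c)" for w a c
    using bilH by (auto simp: bilinear_def)
  have bilL: "bilinear L"
    unfolding bilinear_def L[abs_def]
    by (auto intro!: linear_compose_sub linHu linHu' linH)
  have symL: "L u v = L v u" for u v
    by (simp add: L symH[of n u v])

  define Q where "Q z w = iter_deriv [z, w] F p" for z w
  define C where "C z w u = iter_deriv [z, w, u] F p" for z w u
  have symQ: "Q z w = Q w z" for z w
    unfolding Q_def by (rule iter_deriv_swap[OF S(1,3,2)])
  have symC1: "C z w u = C w z u" for z w u
    unfolding C_def
    using iter_deriv_swap[OF S(1) smooth_on_iter_deriv[OF S(3), of "[u]"] S(2)] by simp
  have symC2: "C z w u = C z u w" for z w u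
  proof -
    have "frechet_derivative (iter_deriv [w, u] F) (at p) = frechet_derivative (iter_deriv [u, w] F) (at p)"
      by (rule frechet_derivative_cong_open[OF S(1,2)]) (rule iter_deriv_swap[OF S(1,3)])
    then show ?thesis by (simp add: C_def)
  qed
  note eqs = isometry_jet_equations[OF S T(1) bil T(3) F iso, folded Q_def C_def H_def]
  have "h p (Q w u) v = 0" for w u v
  proof -
    have skew: "h p (Q w u) v = - h p (Q w v) u" for w u v
      using eqs(1)[of w u v] sym[OF pT, of u] by simp
    \<comment> \<open>With B(w,u,v) = h(Q(w,u),v), symmetric in the first two slots and skew in the
      last two: B(w,u,v) = -B(w,v,u) = -B(v,w,u) = B(v,u,w) = B(u,v,w) = -B(u,w,v) =
      -B(w,u,v).\<close>
    show ?thesis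
      using skew[of w u v] skew[of v w u] skew[of u v w] by (simp add: symQ)
  qed
  then have Qker: "Q w u \<in> form_kernel (h p)" for w u
    by (simp add: form_kernel_def)
  \<comment> \<open>Reading off the coefficient by an inner product lets \<open>q\<close> inherit
    linearity and symmetry from \<open>Q\<close>.\<close>
  define q where "q z w = (Q z w \<bullet> n) / (n \<bullet> n)" for z w
  have Qq: "Q z w = q z w *\<^sub>R n" for z w
    using dim_1_multiple[OF dim1[OF pT] subspace_form_kernel[OF bil[OF pT]] n(2,1) Qker[of z w]] n(1)
    by (auto simp: q_def)
  have symq: "q z w = q w z" for z w by (simp add: q_def symQ[of z w])
  have linq: "linear (\<lambda>z. q z w)" for w
  proof -
    have "linear (\<lambda>z. Q z w)"
      unfolding Q_def
      using linear_frechet_derivative[OF smooth_on_differentiable[OF smooth_on_frechet_derivative[OF S(3)] S(2)]]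
      by simp
    from linear_add[OF this] linear_cmul[OF this] show ?thesis
      by (intro linearI) (simp_all add: q_def inner_add_left add_divide_distrib)
  qed
  define t where "t z w u v = h p (C z w u) v" for z w u v
  have hn: "h p n v = 0" "h p v n = 0" for v
    using n(2) sym[OF pT] by (auto simp: form_kernel_def)
  \<comment> \<open>With \<open>Q\<close> a multiple of \<open>n\<close>, the terms quadratic in
    \<open>Q\<close> vanish, because \<open>n\<close> is in the kernel of
    \<open>h p\<close>.\<close>
  have eq2: "q z w * H n u v + q z u * H w n v + q z v * H w n u + q w u * H z n v + q w v * H z n u
      + t z w u v + t z w v u = 0" for z w u v
    using eqs(2)[of z w u v] sym[OF pT, of u "C z w v"] symH[of w u n] symH[of z u n]
    by (simp add: t_def Qq hn bilinear_lmul[OF bilH] bilinear_rmul[OF bilH] linear_cmul[OF linH]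
        bilinear_lmul[OF bil[OF pT]] bilinear_rmul[OF bil[OF pT]])
  have KN: "q z w * L u v + q u v * L z w = q z u * L w v + q w v * L z u" for z w u v
  proof -
    have t: "t u v z w = t z u v w" "t u v w z = t w v u z" "t z u w v = t z w u v"
        "t w v z u = t z w v u"
      unfolding t_def using symC1 symC2 by metis+
    have qs: "q u z = q z u" "q v z = q z v" "q v w = q w v" "q u w = q w u" "q w z = q z w" "q v u = q u v"
      by (rule symq)+
    \<comment> \<open>This is the combination which gives the linearised curvature of a symmetric form; it
      cancels the third derivatives of \<open>F\<close>.\<close>
    show ?thesis
      using eq2[of z w u v] eq2[of u v z w] eq2[of z u w v] eq2[of w v z u]
      by (simp add: t qs L algebra_simps)
  qed
  have "q z w = 0"
    by (rule kulkarni_nomizu_zero[OF _ bilL symL _ linq symq KN])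
      (use dim4 dim1[OF pT] kerL in auto)
  then show ?thesis using Qq[of z w] by (simp add: Q_def)
qed

section \<open>From coordinates to jets on the manifold\<close>

theorem theorem3p1:
  fixes A :: "('m::{t2_space, second_countable_topology}, 'n::finite) chart set"
    and g :: "('m, 'n) chart \<Rightarrow> 'n form_field"
    and x :: 'm and \<phi> :: "'m \<Rightarrow> 'm"
  assumes "CARD('n) \<ge> 4"
    and "smooth_atlas A"
    and "lightlike_metric A g"
    and "generic_metric A g"
    and "\<phi> \<in> local_diffeos A x"
    and "jet A 3 x \<phi> \<in> Iso A g 3 x"
    and "jet A 1 x \<phi> = jet A 1 x id"
  shows "jet A 2 x \<phi> = jet A 2 x id"
proof -
  \<comment> \<open>Membership in \<open>Iso\<close> gives the isometry equations for some
    representative \<psi> of the 3-jet, not for \<phi> itself; order 3 of the jet means order 2 in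
    the equations.\<close>
  obtain \<psi> where \<psi>: "\<psi> \<in> local_diffeos A x" "jet A 3 x \<phi> = jet A 3 x \<psi>"
    and iso: "\<And>c u v. c \<in> A \<Longrightarrow> x \<in> cdom c \<Longrightarrow> eq_to_order 2 (cmap c x)
           (\<lambda>y. pullback (crep c c \<psi>) (g c) y u v - g c y u v) (\<lambda>y. 0)"
  proof -
    from assms(6) obtain \<psi> k where "jet A 3 x \<phi> = jet A 3 x \<psi>" "3 = k + 1" "\<psi> \<in> local_diffeos A x"
      and "\<forall>c\<in>A. x \<in> cdom c \<longrightarrow> (\<forall>u v. eq_to_order k (cmap c x)
           (\<lambda>y. pullback (crep c c \<psi>) (g c) y u v - g c y u v) (\<lambda>y. 0))"
      unfolding Iso_def by blast
    moreover from this(2) have "k = 2" by simp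
    ultimately show ?thesis using that by blast
  qed
  \<comment> \<open>Since \<phi> lies in its own jet class, equality of classes becomes agreement of
    derivatives in the charts.\<close>
  have self: "\<phi> \<in> jet A k x \<phi>" for k
    using assms(5) by (simp add: jet_def eq_to_order_def)
  have "eq_to_order 2 (cmap c x) (crep c c \<phi>) (crep c c id)" if c: "c \<in> A" "x \<in> cdom c" for c
  proof -
    let ?p = "cmap c x" and ?F = "crep c c \<psi>"
    have jet3: "eq_to_order 3 ?p (crep c c \<phi>) ?F"
      using self[of 3] \<psi>(2) c by (auto simp: jet_def)
    have jet1: "eq_to_order 1 ?p (crep c c \<phi>) (crep c c id)"
      using self[of 1] assms(7) c by (auto simp: jet_def)
    have chart: "open (cdom c)" "open (crange c)" "homeomorphism (cdom c) (crange c) (cmap c) (cinv c)"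
      using assms(2) c(1) by (auto simp: smooth_atlas_def is_chart_def)
    have pT: "?p \<in> crange c" using c(2) by (simp add: crange_def)
    \<comment> \<open>The chart expression of the identity is the identity only on the range of the
      chart, so its derivatives are compared there.\<close>
    have id_rep: "crep c c id y = y" if "y \<in> crange c" for y
      using chart(3) that by (simp add: crep_def homeomorphism_def)
    have id_iter: "iter_deriv vs (crep c c id) ?p = iter_deriv vs (\<lambda>y. y) ?p" for vs
      by (rule iter_deriv_cong_open[OF chart(2) id_rep pT])
    obtain U where U: "open U" "x \<in> U" "smooth_map_on A U \<psi>" and fixed: "\<psi> x = x"
      using \<psi>(1) by (auto simp: local_diffeos_def)
    \<comment> \<open>These are the coordinates of points near \<open>x\<close> whose image stays in
      the same chart.\<close>
    define S where "S = cmap c ` (U \<inter> cdom c \<inter> \<psi> -` cdom c)"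
    have "open (U \<inter> \<psi> -` cdom c)"
      using U(1,3) chart(1) by (auto simp: smooth_map_on_def intro: continuous_open_preimage)
    then have "openin (top_of_set (cdom c)) (U \<inter> cdom c \<inter> \<psi> -` cdom c)"
      using chart(1) by (auto simp: openin_open Int_ac)
    then have "openin (top_of_set (crange c)) S"
      unfolding S_def using homeomorphism_imp_open_map[OF chart(3)] by blast
    then have S: "open S" using chart(2) openin_open_trans by blast
    have pS: "?p \<in> S" using U(2) c(2) fixed by (auto simp: S_def)
    have smoothF: "smooth_on S ?F"
      using U(3) c(1) by (auto simp: smooth_map_on_def S_def)
    have FS: "?F y \<in> crange c" if "y \<in> S" for y
      using that chart(3) by (auto simp: S_def crep_def crange_def homeomorphism_def)
    have Fp: "?F ?p = ?p"
      using chart(3) c(2) fixed by (simp add: crep_def homeomorphism_def)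
    \<comment> \<open>Agreement of \<psi> with \<phi> up to order 3 and of \<phi> with the identity
      up to order 1 are combined.\<close>
    have DF: "frechet_derivative ?F (at ?p) v = v" for v
    proof -
      have "iter_deriv [v] ?F ?p = iter_deriv [v] (crep c c id) ?p"
        using jet3[unfolded eq_to_order_def, rule_format, of "[v]"]
          jet1[unfolded eq_to_order_def, rule_format, of "[v]"] by simp
      then show ?thesis using id_iter[of "[v]"] by simp
    qed
    have metric: "lightlike_form (g c y)" "smooth_on (crange c) (\<lambda>y. g c y u v)" if "y \<in> crange c" for y u v
      using assms(3) c(1) that by (auto simp: lightlike_metric_def)
    have D2: "iter_deriv [z, w] ?F ?p = 0" for z w
    proof (rule second_jet_trivial[OF assms(1) S pS smoothF FS chart(2) metric(1) metric(2)[OF pT] _ Fp DF iso[OF c]])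
      show "\<forall>y\<in>W. form_kernel (lie_derivative X (g c) y) = form_kernel (g c y)"
        if "open W" "W \<subseteq> crange c" "smooth_on W X" "\<forall>y\<in>W. X y \<noteq> 0 \<and> X y \<in> form_kernel (g c y)" for W X
        using assms(4) c(1) that unfolding generic_metric_def by blast
    qed
    show ?thesis
      unfolding eq_to_order_def
    proof (intro allI impI)
      fix vs :: "(real ^ 'n) list"
      assume len: "length vs \<le> 2"
      show "iter_deriv vs (crep c c \<phi>) ?p = iter_deriv vs (crep c c id) ?p"
      proof (cases "length vs \<le> 1")
        case True
        then show ?thesis using jet1 by (simp add: eq_to_order_def)
      next
        case False
        then have "length vs = Suc (Suc 0)" using len by simp
        then obtain z w where vs: "vs = [z, w]" by (auto simp: length_Suc_conv)
        have "iter_deriv vs (crep c c \<phi>) ?p = 0"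
          using jet3 len D2 unfolding vs by (simp add: eq_to_order_def del: iter_deriv.simps)
        moreover have "iter_deriv [z, w] (\<lambda>y::real ^ 'n. y) = (\<lambda>_. 0)" by simp
        ultimately show ?thesis using id_iter[of vs] unfolding vs by (simp del: iter_deriv.simps)
      qed
    qed
  qed
  then show ?thesis by (auto simp: jet_def eq_to_order_def)
qed

end
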